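(* Let $p,q,m,n$ be integers with $|p|,|q|\geq 2$, $m,n>0$ and $|pq|=mn$, and let $a\in\mathbb{R}$. Let $$A=\begin{pmatrix} p&0\\ a&q\end{pmatrix}\qquad\text{and}\qquad \mathcal{D}=\left\{\begin{pmatrix} i\\ j\end{pmatrix}: 0\leq i\leq m-1,\ 0\leq j\leq n-1\right\}\quad (i,j\in\mathbb{Z}).$$ Then: (i) If $m<|p|$, then $T(A,\mathcal{D})$ is not a tile. (ii) If $m=|p|$, then $T(A,\mathcal{D})$ is a tile. (iii) If $m>|p|$, then: (a) if $a=0$, then $T(A,\mathcal{D})$ is not a tile; (b) if $a\in\mathbb{Z}\setminus\{0\}$ and $2n-1\geq |q|$, then $T(A,\mathcal{D})$ is not a tile.
   Context: For an expanding real $2\times 2$ matrix $A$ (all eigenvalues have modulus $>1$) and a finite set $\mathcal{D}\subset\mathbb{R}^2$, the self-affine set $T(A,\mathcal{D})$ is the unique nonempty compact set $T\subset\mathbb{R}^2$ satisfying $T=\bigcup_{d\in\mathcal{D}}A^{-1}(T+d)$; equivalently $T(A,\mathcal{D})=\left\{\sum_{k\geq 1}A^{-k}d_k: d_k\in\mathcal{D}\right\}$. When $\#\mathcal{D}=|\det A|$ is an integer, $T(A,\mathcal{D})$ is called a (self-affine) tile if it has positive Lebesgue measure. (In that case $T$ tiles $\mathbb{R}^2$: there is a discrete set $\mathcal{J}\subset\mathbb{R}^2$ with $T+\mathcal{J}=\mathbb{R}^2$ and $(T^{\circ}+t)\cap(T^{\circ}+s)=\emptyset$ for all distinct $t,s\in\mathcal{J}$.)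 *)

theory Defs
  imports "HOL-Analysis.Analysis"
begin

text \<open>For expanding \<open>A\<close> (all eigenvalues of modulus \<open>> 1\<close>) and finite nonempty \<open>D\<close>, exactly one
  nonempty compact set satisfies the set equation, so the definite description is meaningful;
  outside that range nothing is claimed about its value.\<close>

definition self_affine_set :: "real^2^2 \<Rightarrow> (real^2) set \<Rightarrow> (real^2) set" where
  "self_affine_set A D =
     (THE T. T \<noteq> {} \<and> compact T \<and>
        T = (\<Union>d\<in>D. (\<lambda>x. matrix_inv A *v (x + d)) ` T))"

definition is_tile :: "real^2^2 \<Rightarrow> (real^2) set \<Rightarrow> bool" where
  "is_tile A D \<longleftrightarrow>
     finite D \<and> real (card D) = \<bar>det A\<bar> \<and> emeasure lebesgue (self_affine_set A D) > 0"

text \<open>\<open>vector\<close> lists the rows, so the off-diagonal entry \<open>a\<close> is in the lower left corner.\<close>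

definition lower_tri :: "int \<Rightarrow> real \<Rightarrow> int \<Rightarrow> real^2^2" where
  "lower_tri p a q = vector [vector [of_int p, 0], vector [a, of_int q]]"

definition rect_digits :: "int \<Rightarrow> int \<Rightarrow> (real^2) set" where
  "rect_digits m n =
     {vector [of_int i, of_int j] | i j :: int. 0 \<le> i \<and> i \<le> m - 1 \<and> 0 \<le> j \<and> j \<le> n - 1}"

end

theory Submission
  imports Defs
begin

text \<open>
  Put \<open>T = T(A, D)\<close>. Since \<open>A T = T + D\<close>, every \<open>x \<in> T\<close> has a digit \<open>d \<in> D\<close> with \<open>A x - d \<in> T\<close>;
  conversely \<open>T\<close> contains each bounded set \<open>E\<close> in which every point has such a digit
  (\<open>subset_self_affine_set\<close>). The cardinality of \<open>D\<close> is \<open>m n = \<bar>p q\<bar> = \<bar>det A\<bar>\<close>, so the question is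
  only whether \<open>T\<close> is a null set.

  \<^bold>\<open>Null sets.\<close> If \<open>f\<close> is linear and \<open>f\<^sup>k S\<close> is covered by fewer than \<open>\<bar>det f\<bar>\<^sup>k\<close> translates of
  the compact set \<open>S\<close>, comparison of measures shows that \<open>S\<close> is null
  (\<open>negligible_of_few_translates\<close>). This is used in two ways.
  The first coordinate of \<open>T\<close> satisfies \<open>p x = x' + i\<close> with only \<open>m\<close> values of \<open>i\<close>, and for \<open>a = 0\<close> the
  second one satisfies \<open>q y = y' + j\<close> with only \<open>n\<close> values of \<open>j\<close>. If \<open>m < \<bar>p\<bar>\<close>, respectively
  \<open>n < \<bar>q\<bar>\<close> (which is equivalent to \<open>m > \<bar>p\<bar>\<close>), then a strip over that projection is null, and it
  contains \<open>T\<close> (\<open>negligible_of_expanding_projection\<close>).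
  If \<open>a\<close> is an integer, \<open>m > \<bar>p\<bar>\<close> and \<open>2 n - 1 \<ge> \<bar>q\<bar>\<close>, then two different digit words
  of the same length have the same value \<open>\<Sum> A\<^sup>k d\<^sub>k\<close>, so that again too few translates are needed
  (\<open>negligible_of_radix_collision\<close>). The collision amounts to digits \<open>(i\<^sub>k, j\<^sub>k)\<close> with
  \<open>\<bar>i\<^sub>k\<bar> < m\<close>, \<open>\<bar>j\<^sub>k\<bar> < n\<close>, not all zero, and \<open>\<Sum> A\<^sup>k (i\<^sub>k, j\<^sub>k) = 0\<close>. Take \<open>i\<^sub>0 = - p\<close>, \<open>i\<^sub>1 = 1\<close> and all other
  \<open>i\<^sub>k = 0\<close>; then the condition becomes \<open>\<Sum> q\<^sup>k j\<^sub>k = - a\<close>, and every integer has such an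
  expansion, because the integers of modulus below \<open>n\<close> meet all residue classes modulo \<open>q\<close>
  and \<open>n < \<bar>q\<bar>\<close> makes the successive quotients decrease to \<open>0\<close>
  (\<open>lower_tri_radix_collision\<close>).

  \<^bold>\<open>Positive measure.\<close> If \<open>m = \<bar>p\<bar>\<close> and \<open>n = \<bar>q\<bar>\<close>, choose unit intervals \<open>I\<close> and \<open>J\<close> such that
  every \<open>x \<in> I\<close> has a digit \<open>i\<close> with \<open>\<phi> x = p x - i \<in> I\<close>, and likewise for \<open>q\<close> and \<open>J\<close>. With a bounded
  solution \<open>g\<close> of \<open>g (\<phi> x) = q g x + a x\<close> on \<open>I\<close>, the set \<open>E\<close> of all \<open>(x, y)\<close> with \<open>x \<in> I\<close> and
  \<open>y - g x \<in> J\<close> lies in \<open>T\<close>. The integer translates of \<open>E\<close> cover the plane, so \<open>T\<close> is not null.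
\<close>

section \<open>Attractors of expanding matrices\<close>

lemma matrix_inv_cancel:
  fixes A :: "real^'n^'n"
  assumes "invertible A"
  shows "A *v (matrix_inv A *v x) = x" "matrix_inv A *v (A *v x) = x"
proof -
  have "\<exists>B. A ** B = mat 1 \<and> B ** A = mat 1"
    using assms by (simp add: invertible_def)
  then have "A ** matrix_inv A = mat 1 \<and> matrix_inv A ** A = mat 1"
    unfolding matrix_inv_def by (rule someI_ex)
  then show "A *v (matrix_inv A *v x) = x" "matrix_inv A *v (A *v x) = x"
    by (simp_all add: matrix_vector_mul_assoc)
qed

text \<open>
  A planar matrix that expands by the factor \<open>r > 1\<close> when vectors are measured by \<open>N\<close>, a subadditive
  function comparable with the Euclidean norm. An expanding matrix need not enlarge the Euclidean
  norm itself.
\<close>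
locale expanding_digit_system =
  fixes A :: "real^2^2" and D :: "(real^2) set" and N :: "real^2 \<Rightarrow> real" and r b c :: real
  assumes finite_D: "finite D" and D_nonempty: "D \<noteq> {}"
    and N_triangle: "N (x + y) \<le> N x + N y"
    and norm_le_N: "norm x \<le> b * N x" and N_le_norm: "N x \<le> c * norm x"
    and b_pos: "b > 0" and c_pos: "c > 0"
    and r_gt_1: "r > 1" and N_expand: "r * N x \<le> N (A *v x)"
begin

lemma N_nonneg: "N x \<ge> 0"
  using norm_le_N[of x] norm_ge_zero[of x] b_pos
  by (smt (verit) mult_pos_neg)

lemma N_zero: "N 0 = 0"
  using N_le_norm[of 0] N_nonneg[of 0] by simp

lemma N_eq_zeroD: "N x \<le> 0 \<Longrightarrow> x = 0"
  using norm_le_N[of x] b_pos by (smt (verit) mult_nonneg_nonpos norm_le_zero_iff)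

lemma A_invertible: "invertible A"
proof -
  have "x = 0" if "A *v x = 0" for x
    using N_expand[of x] N_nonneg[of x] r_gt_1 that N_zero
    by (intro N_eq_zeroD) (smt (verit) mult_less_cancel_right1 mult_pos_pos)
  then show ?thesis
    using invertible_left_inverse matrix_left_invertible_ker by blast
qed

lemmas A_inv = matrix_inv_cancel[OF A_invertible]

text \<open>The set operator whose nonempty compact fixed point is the self-affine set.\<close>
definition branches :: "(real^2) set \<Rightarrow> (real^2) set" where
  "branches E = (\<Union>d\<in>D. (\<lambda>x. matrix_inv A *v (x + d)) ` E)"

lemma mem_branches_iff: "x \<in> branches E \<longleftrightarrow> (\<exists>d\<in>D. A *v x - d \<in> E)"
proof
  assume "x \<in> branches E"
  then obtain d y where "d \<in> D" "y \<in> E" "x = matrix_inv A *v (y + d)"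
    unfolding branches_def by blast
  then show "\<exists>d\<in>D. A *v x - d \<in> E"
    by (intro bexI[of _ d]) (simp_all add: A_inv)
next
  assume "\<exists>d\<in>D. A *v x - d \<in> E"
  then obtain d where "d \<in> D" "A *v x - d \<in> E" by blast
  moreover have "x = matrix_inv A *v ((A *v x - d) + d)"
    by (simp add: A_inv)
  ultimately show "x \<in> branches E"
    unfolding branches_def by blast
qed

lemma branches_mono: "E \<subseteq> F \<Longrightarrow> branches E \<subseteq> branches F"
  unfolding subset_iff mem_branches_iff by blast

lemma bounded_iff_N: "bounded E \<longleftrightarrow> (\<exists>R. \<forall>x\<in>E. N x \<le> R)"
proof
  assume "bounded E"
  then obtain R where "\<forall>x\<in>E. norm x \<le> R" by (auto simp: bounded_iff)
  then have "\<forall>x\<in>E. N x \<le> c * R"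
    using N_le_norm c_pos by (meson mult_left_mono order.trans less_imp_le)
  then show "\<exists>R. \<forall>x\<in>E. N x \<le> R" by blast
next
  assume "\<exists>R. \<forall>x\<in>E. N x \<le> R"
  then obtain R where "\<forall>x\<in>E. N x \<le> R" by blast
  then have "\<forall>x\<in>E. norm x \<le> b * R"
    using norm_le_N b_pos by (meson mult_left_mono order.trans less_imp_le)
  then show "bounded E" by (auto simp: bounded_iff)
qed

text \<open>
  A point of \<open>E\<close> is followed \<open>k\<close> steps along its digits; pulling a point of \<open>F\<close> back along the same
  digits divides the \<open>N\<close>-distance by at least \<open>r\<^sup>k\<close>. This gives both the uniqueness of the fixed
  point and the bound on all bounded sets \<open>E \<subseteq> branches E\<close>.
\<close>
lemma approximate_by_invariant_set:
  assumes bdd: "bounded E" and sub: "E \<subseteq> branches E"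
    and ne: "F \<noteq> {}" and inv: "branches F \<subseteq> F" and "x \<in> E" "e > 0"
  shows "\<exists>y\<in>F. N (x - y) < e"
proof -
  obtain y0 where y0: "y0 \<in> F" using ne by blast
  have "bounded ((\<lambda>x. x - y0) ` E)"
    using bounded_translation[OF bdd, of "- y0"] by simp
  then obtain R where R: "\<And>x. x \<in> E \<Longrightarrow> N (x - y0) \<le> R"
    unfolding bounded_iff_N by auto
  have *: "\<exists>y\<in>F. r ^ k * N (x - y) \<le> R" if "x \<in> E" for x k
    using that
  proof (induction k arbitrary: x)
    case 0
    then show ?case using y0 R by auto
  next
    case (Suc k)
    then obtain d where d: "d \<in> D" "A *v x - d \<in> E"
      using sub unfolding subset_iff mem_branches_iff by blast
    then obtain z where z: "z \<in> F" "r ^ k * N (A *v x - d - z) \<le> R"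
      using Suc.IH by blast
    define y where "y = matrix_inv A *v (z + d)"
    have "y \<in> F" using inv z d by (auto simp: branches_def y_def)
    have "A *v (x - y) = A *v x - d - z"
      by (simp add: y_def A_inv matrix_vector_mult_diff_distrib)
    then have "r * N (x - y) \<le> N (A *v x - d - z)"
      using N_expand[of "x - y"] by simp
    then have "r ^ k * (r * N (x - y)) \<le> r ^ k * N (A *v x - d - z)"
      using r_gt_1 by (intro mult_left_mono) auto
    with z \<open>y \<in> F\<close> show ?case
      by (intro bexI[of _ y]) (auto simp: mult_ac)
  qed
  obtain k where k: "r ^ k > R / e"
    using r_gt_1 real_arch_pow by blast
  obtain y where y: "y \<in> F" "r ^ k * N (x - y) \<le> R"
    using * \<open>x \<in> E\<close> by blast
  have "R < r ^ k * e" using k \<open>e > 0\<close> by (simp add: divide_less_eq mult.commute)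
  then have "r ^ k * N (x - y) < r ^ k * e" using y by linarith
  then have "N (x - y) < e" using r_gt_1 by simp
  with y show ?thesis by blast
qed

lemma subset_closed_invariant_set:
  assumes "bounded E" "E \<subseteq> branches E" "F \<noteq> {}" "branches F \<subseteq> F" "closed F"
  shows "E \<subseteq> F"
proof
  fix x assume "x \<in> E"
  have "\<exists>y\<in>F. dist y x < e" if "e > 0" for e
  proof -
    have "e / b > 0" using that b_pos by simp
    then obtain y where "y \<in> F" "N (x - y) < e / b"
      using approximate_by_invariant_set[OF assms(1-4) \<open>x \<in> E\<close>] by blast
    then show ?thesis
      using norm_le_N[of "x - y"] b_pos
      by (intro bexI[of _ y]) (auto simp: dist_norm norm_minus_commute field_simps)
  qed
  then show "x \<in> F"
    using \<open>closed F\<close> by (metis closure_approachable closure_closed)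
qed

text \<open>The radius of an \<open>N\<close>-ball that \<open>branches\<close> maps into itself.\<close>
definition radius :: real where
  "radius = (\<Sum>d\<in>D. N d) / (r - 1)"

lemma branches_ball: "branches {x. N x \<le> radius} \<subseteq> {x. N x \<le> radius}"
proof
  fix x assume "x \<in> branches {x. N x \<le> radius}"
  then obtain d where d: "d \<in> D" "N (A *v x - d) \<le> radius"
    by (auto simp: mem_branches_iff)
  have "N d \<le> (\<Sum>d\<in>D. N d)"
    using d finite_D N_nonneg by (intro member_le_sum) auto
  also have "\<dots> = (r - 1) * radius" using r_gt_1 by (simp add: radius_def)
  finally have "r * N x \<le> r * radius"
    using N_expand[of x] N_triangle[of "A *v x - d" d] d by (simp add: algebra_simps)
  then show "x \<in> {x. N x \<le> radius}" using r_gt_1 by simp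
qed

lemma radius_nonneg: "radius \<ge> 0"
  unfolding radius_def using r_gt_1 N_nonneg by (intro divide_nonneg_pos sum_nonneg) auto

lemma N_le_radius:
  assumes "bounded E" "E \<subseteq> branches E" "x \<in> E"
  shows "N x \<le> radius"
proof (rule field_le_epsilon)
  fix e :: real assume "e > 0"
  have "{x. N x \<le> radius} \<noteq> {}"
    using radius_nonneg N_zero by (metis empty_iff mem_Collect_eq)
  then obtain y where "N y \<le> radius" "N (x - y) < e"
    using approximate_by_invariant_set[OF assms(1,2) _ branches_ball assms(3) \<open>e > 0\<close>] by auto
  then show "N x \<le> radius + e" using N_triangle[of "x - y" y] by simp
qed

text \<open>
  Existence of the fixed point: it is obtained as the greatest bounded set contained in its own
  image. The union is bounded because all its members lie in one ball (\<open>N_le_radius\<close>).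
\<close>
definition attractor :: "(real^2) set" where
  "attractor = \<Union>{E. bounded E \<and> E \<subseteq> branches E}"

lemma subset_attractor: "bounded E \<Longrightarrow> E \<subseteq> branches E \<Longrightarrow> E \<subseteq> attractor"
  unfolding attractor_def by blast

lemma attractor_bounded: "bounded attractor"
proof -
  have "N x \<le> radius" if "x \<in> attractor" for x
    using that N_le_radius unfolding attractor_def by auto
  then show ?thesis unfolding bounded_iff_N by blast
qed

lemma attractor_subset_branches: "attractor \<subseteq> branches attractor"
proof
  fix x assume "x \<in> attractor"
  then obtain E where E: "bounded E" "E \<subseteq> branches E" "x \<in> E"
    unfolding attractor_def by blast
  then show "x \<in> branches attractor"
    using branches_mono[OF subset_attractor[OF E(1,2)]] by blast
qed

lemma continuous_branch: "continuous_on S (\<lambda>x. matrix_inv A *v (x + d))"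
proof -
  have "continuous_on UNIV ((*v) (matrix_inv A))"
    by (simp add: linear_continuous_on linear_linear)
  then show ?thesis
    by (rule continuous_on_compose2) (auto intro: continuous_intros)
qed

lemma compact_branches: "compact E \<Longrightarrow> compact (branches E)"
  unfolding branches_def using finite_D
  by (intro compact_UN compact_continuous_image continuous_branch) auto

lemma attractor_eq: "branches attractor = attractor"
proof
  show "attractor \<subseteq> branches attractor" by (rule attractor_subset_branches)
  have "compact (branches (closure attractor))"
    using attractor_bounded by (intro compact_branches) (simp add: compact_eq_bounded_closed bounded_closure)
  then have "bounded (branches attractor)"
    by (meson bounded_subset branches_mono closure_subset compact_imp_bounded)
  then show "branches attractor \<subseteq> attractor"
    by (rule subset_attractor) (rule branches_mono[OF attractor_subset_branches])
qed

lemma attractor_compact: "compact attractor"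
proof -
  have cpt: "compact (closure attractor)"
    using attractor_bounded by (simp add: compact_eq_bounded_closed bounded_closure)
  have "closure attractor \<subseteq> branches (closure attractor)"
    using compact_imp_closed[OF compact_branches[OF cpt]]
      attractor_subset_branches branches_mono[OF closure_subset, of attractor]
    by (intro closure_minimal) auto
  then have "closure attractor \<subseteq> attractor"
    using cpt by (intro subset_attractor compact_imp_bounded)
  then show ?thesis
    using cpt closure_subset by (metis subset_antisym)
qed

lemma attractor_nonempty: "attractor \<noteq> {}"
proof -
  obtain d where d: "d \<in> D" using D_nonempty by blast
  \<comment> \<open>The fixed point of a single branch solves \<open>(A - 1) x = d\<close>.\<close>
  have "x = 0" if "(A - mat 1) *v x = 0" for x
  proof -
    have "A *v x = x" using that by (simp add: matrix_vector_mult_diff_rdistrib)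
    then have "(r - 1) * N x \<le> 0" using N_expand[of x] by (simp add: algebra_simps)
    then show ?thesis using r_gt_1 N_eq_zeroD by (simp add: mult_le_0_iff)
  qed
  then have "invertible (A - mat 1)"
    using invertible_left_inverse matrix_left_invertible_ker by blast
  then obtain x where "(A - mat 1) *v x = d"
    using matrix_inv_cancel(1) by blast
  then have "A *v x - d = x" by (simp add: matrix_vector_mult_diff_rdistrib algebra_simps)
  then have "{x} \<subseteq> branches {x}" using d by (auto simp: mem_branches_iff)
  then have "{x} \<subseteq> attractor" by (intro subset_attractor) auto
  then show ?thesis by blast
qed

lemma self_affine_set_eq_attractor: "self_affine_set A D = attractor"
proof -
  have "self_affine_set A D = (THE T. T \<noteq> {} \<and> compact T \<and> T = branches T)"
    unfolding self_affine_set_def branches_def ..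
  also have "\<dots> = attractor"
  proof (rule the_equality)
    show "attractor \<noteq> {} \<and> compact attractor \<and> attractor = branches attractor"
      using attractor_nonempty attractor_compact attractor_eq[symmetric] by blast
  next
    fix T assume "T \<noteq> {} \<and> compact T \<and> T = branches T"
    then have T: "T \<noteq> {}" "compact T" and eq: "T = branches T" by blast+
    show "T = attractor"
    proof
      show "T \<subseteq> attractor"
        by (rule subset_attractor[OF compact_imp_bounded[OF T(2)] equalityD1[OF eq]])
      show "attractor \<subseteq> T"
        by (rule subset_closed_invariant_set[OF attractor_bounded attractor_subset_branches
              T(1) equalityD2[OF eq] compact_imp_closed[OF T(2)]])
    qed
  qed
  finally show ?thesis .
qed

lemma compact_self_affine_set: "compact (self_affine_set A D)"
  by (simp add: self_affine_set_eq_attractor attractor_compact)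

lemma self_affine_set_step:
  assumes "x \<in> self_affine_set A D"
  shows "\<exists>d\<in>D. A *v x - d \<in> self_affine_set A D"
  using subsetD[OF attractor_subset_branches] assms
  unfolding self_affine_set_eq_attractor mem_branches_iff .

lemma subset_self_affine_set:
  assumes "bounded E" "\<And>x. x \<in> E \<Longrightarrow> \<exists>d\<in>D. A *v x - d \<in> E"
  shows "E \<subseteq> self_affine_set A D"
  unfolding self_affine_set_eq_attractor
  using assms by (intro subset_attractor) (auto simp: mem_branches_iff)

end

section \<open>Lower triangular matrices and rectangular digit sets\<close>

lemma lower_tri_mult [simp]:
  "(lower_tri p a q *v v) $ 1 = of_int p * v $ 1"
  "(lower_tri p a q *v v) $ 2 = a * v $ 1 + of_int q * v $ 2"
  by (simp_all add: lower_tri_def matrix_vector_mult_def sum_2)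

lemma det_lower_tri: "det (lower_tri p a q) = of_int (p * q)"
  by (simp add: lower_tri_def det_2)

lemma rect_digits_eq_image:
  "rect_digits m n = (\<lambda>(i, j). vector [of_int i, of_int j]) ` ({0..m - 1} \<times> {0..n - 1})"
  unfolding rect_digits_def by force

lemma vector_of_int_inject:
  "(vector [of_int i, of_int j] :: real^2) = vector [of_int i', of_int j'] \<longleftrightarrow> i = i' \<and> j = j'"
  by (auto simp: vec_eq_iff forall_2)

lemma finite_rect_digits: "finite (rect_digits m n)"
  by (simp add: rect_digits_eq_image)

lemma card_rect_digits:
  assumes "m > 0" "n > 0"
  shows "int (card (rect_digits m n)) = m * n"
proof -
  have "card (rect_digits m n) = card ({0..m - 1} \<times> {0..n - 1})"
    unfolding rect_digits_eq_image
    by (intro card_image) (auto simp: inj_on_def vector_of_int_inject)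
  then show ?thesis using assms by (simp add: card_cartesian_product)
qed

text \<open>The weight \<open>K\<close> on the first coordinate absorbs the off-diagonal entry \<open>a\<close>.\<close>
lemma lower_tri_expanding_digit_system:
  fixes p q :: int and a :: real
  assumes p: "\<bar>p\<bar> \<ge> 2" and q: "\<bar>q\<bar> \<ge> 2" and "finite D" "D \<noteq> {}"
  defines "K \<equiv> 2 * \<bar>a\<bar> + 1"
  shows "expanding_digit_system (lower_tri p a q) D (\<lambda>v. K * \<bar>v $ 1\<bar> + \<bar>v $ 2\<bar>) (3/2) 1 (K + 1)"
proof
  fix x y :: "real^2"
  have K: "K \<ge> 1" by (simp add: K_def)
  show "K * \<bar>(x + y) $ 1\<bar> + \<bar>(x + y) $ 2\<bar> \<le> K * \<bar>x $ 1\<bar> + \<bar>x $ 2\<bar> + (K * \<bar>y $ 1\<bar> + \<bar>y $ 2\<bar>)"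
  proof -
    have "K * \<bar>(x + y) $ 1\<bar> \<le> K * (\<bar>x $ 1\<bar> + \<bar>y $ 1\<bar>)"
      using K by (intro mult_left_mono) auto
    moreover have "\<bar>(x + y) $ 2\<bar> \<le> \<bar>x $ 2\<bar> + \<bar>y $ 2\<bar>" by auto
    ultimately show ?thesis by (simp add: algebra_simps)
  qed
  have "\<bar>x $ 1\<bar> \<le> K * \<bar>x $ 1\<bar>" using K by (simp add: mult_le_cancel_right1)
  then show "norm x \<le> 1 * (K * \<bar>x $ 1\<bar> + \<bar>x $ 2\<bar>)"
    using norm_le_l1_cart[of x] by (simp add: sum_2)
  have "K * \<bar>x $ 1\<bar> \<le> K * norm x" "\<bar>x $ 2\<bar> \<le> norm x"
    using K component_le_norm_cart[of x] by (auto intro: mult_left_mono)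
  then show "K * \<bar>x $ 1\<bar> + \<bar>x $ 2\<bar> \<le> (K + 1) * norm x" by (simp add: algebra_simps)
  have "2 * \<bar>x $ 1\<bar> \<le> \<bar>of_int p * x $ 1\<bar>"
    unfolding abs_mult using p by (intro mult_right_mono) linarith+
  then have 1: "K * (2 * \<bar>x $ 1\<bar>) \<le> K * \<bar>of_int p * x $ 1\<bar>"
    using K by (intro mult_left_mono) auto
  have 2: "2 * \<bar>x $ 2\<bar> \<le> \<bar>of_int q * x $ 2\<bar>"
    unfolding abs_mult using q by (intro mult_right_mono) linarith+
  have 3: "\<bar>of_int q * x $ 2\<bar> \<le> \<bar>a * x $ 1 + of_int q * x $ 2\<bar> + \<bar>a * x $ 1\<bar>" by linarith
  have 4: "\<bar>a * x $ 1\<bar> \<le> K / 2 * \<bar>x $ 1\<bar>"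
    unfolding abs_mult by (intro mult_right_mono) (auto simp: K_def)
  have "3 / 2 * (K * \<bar>x $ 1\<bar> + \<bar>x $ 2\<bar>) \<le> K * \<bar>of_int p * x $ 1\<bar> + \<bar>a * x $ 1 + of_int q * x $ 2\<bar>"
  proof -
    have "3 / 2 * (X + Y) \<le> P + W"
      if "2 * X \<le> P" "2 * Y \<le> Q" "Q \<le> W + Z" "Z \<le> X / 2" "0 \<le> Y" for X Y P Q W Z :: real
      using that by argo
    moreover have "2 * (K * \<bar>x $ 1\<bar>) \<le> K * \<bar>of_int p * x $ 1\<bar>" using 1 by (simp add: mult_ac)
    moreover have "\<bar>a * x $ 1\<bar> \<le> K * \<bar>x $ 1\<bar> / 2" using 4 by simp
    ultimately show ?thesis using 2 3 abs_ge_zero by blast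
  qed
  then show "3 / 2 * (K * \<bar>x $ 1\<bar> + \<bar>x $ 2\<bar>)
      \<le> K * \<bar>(lower_tri p a q *v x) $ 1\<bar> + \<bar>(lower_tri p a q *v x) $ 2\<bar>"
    by simp
qed (use assms in \<open>auto simp: K_def\<close>)

section \<open>Covering by too few translates\<close>

lemma measure_linear_funpow:
  fixes f :: "real^'n::{finite,wellorder} \<Rightarrow> real^'n::_"
  assumes f: "linear f" and S: "compact S"
  shows "compact ((f ^^ k) ` S) \<and>
    measure lebesgue ((f ^^ k) ` S) = \<bar>det (matrix f)\<bar> ^ k * measure lebesgue S"
proof (induction k)
  case 0
  then show ?case using S by simp
next
  case (Suc k)
  have eq: "(f ^^ Suc k) ` S = f ` ((f ^^ k) ` S)" by (simp add: image_image)
  have "measure lebesgue (f ` ((f ^^ k) ` S))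
      = \<bar>det (matrix f)\<bar> * measure lebesgue ((f ^^ k) ` S)"
    using f Suc by (intro measure_linear_image lmeasurable_compact) auto
  moreover have "compact (f ` ((f ^^ k) ` S))"
    using Suc f compact_continuous_image[of "(f ^^ k) ` S" f] linear_continuous_on[of f]
    by (simp add: linear_linear)
  ultimately show ?case using Suc unfolding eq by simp
qed

lemma negligible_of_few_translates:
  fixes f :: "real^'n::{finite,wellorder} \<Rightarrow> real^'n::_"
  assumes f: "linear f" and S: "compact S" and U: "finite U"
    and card: "real (card U) < \<bar>det (matrix f)\<bar> ^ k"
    and sub: "(f ^^ k) ` S \<subseteq> (\<Union>u\<in>U. (+) u ` S)"
  shows "negligible S"
proof -
  have meas: "S \<in> lmeasurable" using S by (rule lmeasurable_compact)
  have trans: "(+) u ` S \<in> lmeasurable" for u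
    using S by (intro lmeasurable_compact compact_translation)
  have "\<bar>det (matrix f)\<bar> ^ k * measure lebesgue S = measure lebesgue ((f ^^ k) ` S)"
    using measure_linear_funpow[OF f S] by simp
  also have "\<dots> \<le> measure lebesgue (\<Union>u\<in>U. (+) u ` S)"
    using measure_linear_funpow[OF f S] U trans sub
    by (intro measure_mono_fmeasurable fmeasurableD lmeasurable_compact compact_UN compact_translation S) auto
  also have "\<dots> \<le> (\<Sum>u\<in>U. measure lebesgue ((+) u ` S))"
    using U trans by (intro measure_UNION_le) auto
  also have "\<dots> = real (card U) * measure lebesgue S"
    by (simp add: measure_translation)
  finally have "(\<bar>det (matrix f)\<bar> ^ k - real (card U)) * measure lebesgue S \<le> 0"
    by (simp add: algebra_simps)
  then have "measure lebesgue S \<le> 0"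
    using card by (simp add: mult_le_0_iff)
  then show ?thesis
    using meas by (simp add: negligible_iff_measure measure_le_0_iff)
qed

text \<open>
  The set \<open>T\<close> lies in a strip over its projection to the axis \<open>i\<close>. The map multiplying only the
  coordinate \<open>i\<close> by \<open>r\<close> sends the strip into its translates by \<open>C\<close> along that axis.
\<close>
lemma negligible_of_expanding_projection:
  fixes T :: "(real^2) set"
  assumes T: "compact T" and C: "finite C" "real (card C) < \<bar>r\<bar>"
    and step: "\<And>v. v \<in> T \<Longrightarrow> \<exists>w\<in>T. \<exists>c\<in>C. r * v $ i = w $ i + c"
  shows "negligible T"
proof -
  obtain R where R: "\<And>v. v \<in> T \<Longrightarrow> norm v \<le> R"
    using compact_imp_bounded[OF T] by (auto simp: bounded_iff)
  define strip :: "(real^2) \<times> real \<Rightarrow> real^2"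
    where "strip = (\<lambda>(v, t). \<chi> j. if j = i then v $ i else t)"
  define S where "S = strip ` (T \<times> {-R..R})"
  have "continuous_on X strip" for X
    unfolding strip_def case_prod_unfold
  proof (intro continuous_on_vec_lambda)
    fix j
    show "continuous_on X (\<lambda>x. if j = i then fst x $ i else snd x)"
      by (cases "j = i") (auto intro!: continuous_intros)
  qed
  then have S: "compact S"
    unfolding S_def using T by (intro compact_continuous_image compact_Times) auto
  define f :: "real^2 \<Rightarrow> real^2" where "f = (\<lambda>v. \<chi> j. (if j = i then r else 1) * v $ j)"
  have f: "linear f"
    by (intro linearI) (auto simp: f_def vec_eq_iff algebra_simps)
  have "det (matrix f) = (\<Prod>j\<in>UNIV. matrix f $ j $ j)"
    by (rule det_diagonal) (auto simp: matrix_def f_def axis_def)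
  also have "\<dots> = (\<Prod>j\<in>UNIV. if j = i then r else 1)"
    by (simp add: matrix_def f_def axis_def)
  also have "\<dots> = r" by simp
  finally have det: "det (matrix f) = r" .
  define U :: "(real^2) set" where "U = (\<lambda>c. axis i c) ` C"
  have cardU: "card U \<le> card C" unfolding U_def using C by (intro card_image_le)
  have "(f ^^ 1) ` S \<subseteq> (\<Union>u\<in>U. (+) u ` S)"
  proof
    fix z assume "z \<in> (f ^^ 1) ` S"
    then obtain v t where vt: "v \<in> T" "t \<in> {-R..R}" "z = f (strip (v, t))"
      by (auto simp: S_def)
    obtain w c where wc: "w \<in> T" "c \<in> C" "r * v $ i = w $ i + c"
      using step[OF vt(1)] by blast
    have "z = axis i c + strip (w, t)"
      using vt wc by (auto simp: vec_eq_iff f_def strip_def axis_def)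
    moreover have "strip (w, t) \<in> S" using wc vt by (auto simp: S_def)
    ultimately show "z \<in> (\<Union>u\<in>U. (+) u ` S)" using wc by (auto simp: U_def)
  qed
  moreover have "real (card U) < \<bar>det (matrix f)\<bar> ^ 1" using cardU C det by simp
  ultimately have "negligible S"
    using C f S by (intro negligible_of_few_translates[where f = f and U = U and k = 1]) (auto simp: U_def)
  moreover have "T \<subseteq> S"
  proof
    fix v assume v: "v \<in> T"
    obtain j where j: "\<And>k. k = i \<or> k = j" 
      by (metis (full_types) exhaust_2)
    have "\<bar>v $ j\<bar> \<le> R" using component_le_norm_cart[of v j] R[OF v] by linarith
    then have "(v, v $ j) \<in> T \<times> {-R..R}" using v by auto
    moreover have "v = strip (v, v $ j)" using j by (auto simp: vec_eq_iff strip_def)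
    ultimately show "v \<in> S" unfolding S_def by blast
  qed
  ultimately show ?thesis by (rule negligible_subset)
qed

section \<open>Coinciding digit words\<close>

text \<open>
  The value \<open>d\<^sub>0 + f d\<^sub>1 + f\<^sup>2 d\<^sub>2 + \<dots>\<close> of a digit word, least significant digit first. It is used for
  vectors with a matrix as base and for integers with an integer as base.
\<close>
primrec radix_value :: "('a::comm_monoid_add \<Rightarrow> 'a) \<Rightarrow> 'a list \<Rightarrow> 'a" where
  "radix_value f [] = 0"
| "radix_value f (d # ds) = d + f (radix_value f ds)"

lemma funpow_eq_radix_value:
  assumes f: "linear f" and step: "\<And>v. v \<in> S \<Longrightarrow> \<exists>d\<in>D. f v - d \<in> S" and "v \<in> S"
  shows "\<exists>ds. set ds \<subseteq> D \<and> length ds = k \<and> (f ^^ k) v - radix_value f ds \<in> S"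
proof (induction k)
  case 0
  then show ?case using \<open>v \<in> S\<close> by simp
next
  case (Suc k)
  then obtain ds where ds: "set ds \<subseteq> D" "length ds = k" "(f ^^ k) v - radix_value f ds \<in> S"
    by blast
  obtain d where d: "d \<in> D" "f ((f ^^ k) v - radix_value f ds) - d \<in> S"
    using step ds by blast
  then have "(f ^^ Suc k) v - radix_value f (d # ds) \<in> S"
    by (simp add: linear_diff[OF f] algebra_simps)
  then show ?case using ds d by (intro exI[of _ "d # ds"]) auto
qed

text \<open>
  \<open>f\<^sup>k S\<close> is covered by the translates of \<open>S\<close> by the values of the words of length \<open>k\<close>, and a
  collision leaves fewer than \<open>\<bar>det f\<bar>\<^sup>k\<close> values.
\<close>
lemma negligible_of_radix_collision:
  fixes f :: "real^'n::{finite,wellorder} \<Rightarrow> real^'n::_"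
  assumes f: "linear f" and S: "compact S" and D: "finite D" "real (card D) = \<bar>det (matrix f)\<bar>"
    and step: "\<And>v. v \<in> S \<Longrightarrow> \<exists>d\<in>D. f v - d \<in> S"
    and words: "set xs \<subseteq> D" "set ys \<subseteq> D" "length xs = length ys" "xs \<noteq> ys"
    and eq: "radix_value f xs = radix_value f ys"
  shows "negligible S"
proof -
  define W where "W = {ds. set ds \<subseteq> D \<and> length ds = length ys}"
  have W: "finite W" "card W = card D ^ length ys"
    using D by (simp_all add: W_def finite_lists_length_eq card_lists_length_eq)
  have "\<not> inj_on (radix_value f) W"
    using words eq by (auto simp: inj_on_def W_def)
  then have "card (radix_value f ` W) \<noteq> card W"
    using W(1) eq_card_imp_inj_on by blast
  then have "card (radix_value f ` W) < card D ^ length ys"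
    using W card_image_le[of W "radix_value f"] by simp
  then have "real (card (radix_value f ` W)) < real (card D) ^ length ys"
    unfolding of_nat_power[symmetric] of_nat_less_iff .
  then have few: "real (card (radix_value f ` W)) < \<bar>det (matrix f)\<bar> ^ length ys"
    using D(2) by simp
  have cover: "(f ^^ length ys) ` S \<subseteq> (\<Union>u\<in>radix_value f ` W. (+) u ` S)"
  proof
    fix z assume "z \<in> (f ^^ length ys) ` S"
    then obtain v where v: "v \<in> S" "z = (f ^^ length ys) v" by blast
    obtain ds where ds: "ds \<in> W" "z - radix_value f ds \<in> S"
      using funpow_eq_radix_value[where k = "length ys", OF f step v(1)]
      unfolding v(2) W_def by blast
    then have "z \<in> (+) (radix_value f ds) ` S"
      by (intro image_eqI[of _ _ "z - radix_value f ds"]) auto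
    then show "z \<in> (\<Union>u\<in>radix_value f ` W. (+) u ` S)" using ds by blast
  qed
  show ?thesis
    by (rule negligible_of_few_translates[OF f S finite_imageI[OF W(1)] few cover])
qed

lemma balanced_digit:
  fixes q n y :: int
  assumes "n > 0" "2 * n - 1 \<ge> \<bar>q\<bar>" "q \<noteq> 0"
  obtains j z where "\<bar>j\<bar> < n" "y = j + q * z"
proof -
  define s where "s = y mod \<bar>q\<bar>"
  have s: "0 \<le> s" "s < \<bar>q\<bar>" using assms by (auto simp: s_def)
  define j where "j = (if s < n then s else s - \<bar>q\<bar>)"
  have "\<bar>j\<bar> < n" using s assms by (auto simp: j_def)
  moreover have "q dvd y - s" by (simp add: s_def minus_mod_eq_mult_div)
  then have "q dvd y - j" by (auto simp: j_def dvd_add_right_iff algebra_simps)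
  then obtain z where "y - j = q * z" by blast
  then have "y = j + q * z" by simp
  ultimately show ?thesis by (rule that)
qed

text \<open>
  The expansion terminates because \<open>n < \<bar>q\<bar>\<close> makes the quotients strictly decrease in modulus.
\<close>
lemma balanced_expansion:
  fixes q n y :: int
  assumes "n > 0" "2 * n - 1 \<ge> \<bar>q\<bar>" "n < \<bar>q\<bar>"
  shows "\<exists>js. (\<forall>j\<in>set js. \<bar>j\<bar> < n) \<and> radix_value ((*) q) js = y"
proof (induction "nat \<bar>y\<bar>" arbitrary: y rule: less_induct)
  case less
  have q0: "q \<noteq> 0" using assms by auto
  show ?case
  proof (cases "y = 0")
    case True
    then show ?thesis by (intro exI[of _ "[]"]) auto
  next
    case False
    obtain j z where j: "\<bar>j\<bar> < n" "y = j + q * z"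
      using balanced_digit[OF assms(1,2)] q0 by blast
    have "\<bar>z\<bar> < \<bar>y\<bar>"
    proof (rule ccontr)
      assume "\<not> \<bar>z\<bar> < \<bar>y\<bar>"
      then have "\<bar>q\<bar> * \<bar>y\<bar> \<le> \<bar>q * z\<bar>" by (simp add: abs_mult mult_left_mono)
      also have "\<dots> \<le> \<bar>y\<bar> + (\<bar>q\<bar> - 2)" using j assms by linarith
      finally have "(\<bar>q\<bar> - 1) * (\<bar>y\<bar> - 1) \<le> -1" by (simp add: algebra_simps)
      moreover have "(\<bar>q\<bar> - 1) * (\<bar>y\<bar> - 1) \<ge> 0"
        using False assms by (intro mult_nonneg_nonneg) auto
      ultimately show False by linarith
    qed
    then have "nat \<bar>z\<bar> < nat \<bar>y\<bar>" by simp
    from less.hyps[OF this]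
    obtain js where js: "\<forall>j\<in>set js. \<bar>j\<bar> < n" "radix_value ((*) q) js = z" by blast
    show ?thesis
      by (intro exI[of _ "j # js"]) (simp add: j(1) j(2)[symmetric] js)
  qed
qed

text \<open>
  The word of differences is \<open>(- p, j\<^sub>0), (1, j\<^sub>1), (0, j\<^sub>2), (0, j\<^sub>3), \<dots>\<close>, where the \<open>j\<^sub>k\<close> are
  the digits of an expansion of \<open>- b\<close> in base \<open>q\<close>. Since \<open>A (1, y) - (p, 0) = (0, b + q y)\<close>, its value
  is \<open>0\<close>. Positive and negative parts of the coordinates give the two words.
\<close>
lemma lower_tri_radix_collision:
  fixes p q m n b :: int
  assumes n: "n > 0" and q: "2 * n - 1 \<ge> \<bar>q\<bar>" "n < \<bar>q\<bar>" and m: "\<bar>p\<bar> < m" "1 < m"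
  obtains xs ys where "set xs \<subseteq> rect_digits m n" "set ys \<subseteq> rect_digits m n"
    "length xs = length ys" "xs \<noteq> ys"
    "radix_value ((*v) (lower_tri p (of_int b) q)) xs = radix_value ((*v) (lower_tri p (of_int b) q)) ys"
proof -
  let ?f = "(*v) (lower_tri p (of_int b) q)"
  define vec :: "int \<times> int \<Rightarrow> real^2" where "vec = (\<lambda>(i, j). vector [of_int i, of_int j])"
  define pos where "pos = (\<lambda>(i::int, j::int). (max i 0, max j 0))"
  define neg where "neg = (\<lambda>(i::int, j::int). (max (- i) 0, max (- j) 0))"
  have q0: "q \<noteq> 0" using n q by auto
  obtain j0 z0 where j0: "\<bar>j0\<bar> < n" "- b = j0 + q * z0"
    using balanced_digit[OF n q(1)] q0 by blast
  obtain j1 z1 where j1: "\<bar>j1\<bar> < n" "z0 = j1 + q * z1"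
    using balanced_digit[OF n q(1)] q0 by blast
  obtain js where js: "\<forall>j\<in>set js. \<bar>j\<bar> < n" "radix_value ((*) q) js = z1"
    using balanced_expansion[OF n q] by blast
  \<comment> \<open>Two digits are split off so that \<open>j0\<close> and \<open>j1\<close> exist even if the expansion of \<open>- b\<close> is shorter.\<close>
  define ds where "ds = (- p, j0) # (1, j1) # map (Pair 0) js"
  have linear: "linear ?f" by (rule matrix_vector_mul_linear)
  have split: "radix_value ?f (map (vec \<circ> pos) es) - radix_value ?f (map (vec \<circ> neg) es)
      = radix_value ?f (map vec es)" for es
  proof (induction es)
    case (Cons e es)
    have "vec (pos e) - vec (neg e) = vec e"
      by (cases e) (auto simp: vec_def pos_def neg_def vec_eq_iff forall_2 max_def)
    then show ?case
      using Cons linear_diff[OF linear, of "radix_value ?f (map (vec \<circ> pos) es)"]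
      by (simp add: algebra_simps)
  qed simp
  have column: "radix_value ?f (map vec (map (Pair 0) es)) = vec (0, radix_value ((*) q) es)" for es
    by (induction es) (auto simp: vec_def vec_eq_iff forall_2)
  have "- b = j0 + q * (j1 + q * z1)" using j0 j1 by simp
  then have "real_of_int (- b) = real_of_int (j0 + q * (j1 + q * z1))" by (rule arg_cong)
  then have b: "- real_of_int b = of_int j0 + of_int q * (of_int j1 + of_int q * of_int z1)"
    by simp
  have "radix_value ?f (map vec ds) = vec (- p, j0) + ?f (vec (1, j1) + ?f (vec (0, z1)))"
    by (simp only: ds_def list.map radix_value.simps column js(2))
  also have "\<dots> = 0"
    using b by (simp add: vec_def vec_eq_iff forall_2)
  finally have "radix_value ?f (map vec ds) = 0" .
  then have eq: "radix_value ?f (map (vec \<circ> pos) ds) = radix_value ?f (map (vec \<circ> neg) ds)"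
    using split[of ds] by simp
  have bound: "\<bar>fst e\<bar> < m \<and> \<bar>snd e\<bar> < n" if "e \<in> set ds" for e
    using that m n j0(1) j1(1) js(1) by (auto simp: ds_def)
  have image: "rect_digits m n = vec ` ({0..m - 1} \<times> {0..n - 1})"
    by (simp add: rect_digits_eq_image vec_def)
  have digits: "vec (pos e) \<in> rect_digits m n" "vec (neg e) \<in> rect_digits m n"
    if "e \<in> set ds" for e
  proof -
    have "pos e \<in> {0..m - 1} \<times> {0..n - 1}" "neg e \<in> {0..m - 1} \<times> {0..n - 1}"
      using bound[OF that] m n by (cases e; auto simp: pos_def neg_def)+
    then show "vec (pos e) \<in> rect_digits m n" "vec (neg e) \<in> rect_digits m n"
      unfolding image by - (rule imageI, assumption)+
  qed
  have "vec (pos (1, j1)) $ 1 \<noteq> vec (neg (1, j1)) $ 1"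
    by (simp add: vec_def pos_def neg_def)
  then have neq: "map (vec \<circ> pos) ds \<noteq> map (vec \<circ> neg) ds"
    by (auto simp: ds_def)
  show ?thesis
    by (rule that[OF _ _ _ neq eq]) (simp_all add: image_subset_iff digits)
qed

section \<open>The exact rectangle of digits\<close>

text \<open>
  For \<open>p \<le> - 2\<close> the interval of all \<open>\<Sum> p\<^sup>-\<^sup>k i\<^sub>k\<close> with \<open>k \<ge> 1\<close> and \<open>0 \<le> i\<^sub>k < \<bar>p\<bar>\<close> starts at \<open>- p / (p - 1)\<close>.
\<close>
lemma expanding_interval:
  fixes p :: int
  assumes "p \<noteq> 0"
  obtains c :: real where
    "\<And>x. x \<in> {c..c + 1} \<Longrightarrow> \<exists>i\<in>{0..\<bar>p\<bar> - 1}. of_int p * x - of_int i \<in> {c..c + 1}"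
proof -
  define c :: real where "c = (if p > 0 then 0 else - of_int p / (of_int p - 1))"
  have "\<exists>i\<in>{0..\<bar>p\<bar> - 1}. of_int p * x - of_int i \<in> {c..c + 1}" if x: "x \<in> {c..c + 1}" for x
  proof -
    define t where "t = of_int p * x - c"
    have t: "0 \<le> t" "t \<le> of_int \<bar>p\<bar>"
    proof -
      have "0 \<le> t \<and> t \<le> of_int \<bar>p\<bar>"
      proof (cases "p > 0")
        case True
        then show ?thesis
          using x by (auto simp: t_def c_def mult_le_cancel_left1)
      next
        case False
        then have p: "p < 0" using assms by simp
        then have c: "(of_int p - 1) * c = - of_int p"
          by (simp add: c_def)
        have "of_int p * (c + 1) \<le> of_int p * x" "of_int p * x \<le> of_int p * c"
          using p x by (auto intro!: mult_left_mono_neg)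
        moreover have "of_int p * c = c - of_int p" "of_int p * (c + 1) = of_int p * c + of_int p"
          using c by (auto simp: algebra_simps)
        moreover have "of_int \<bar>p\<bar> = - real_of_int p" using p by simp
        ultimately show ?thesis unfolding t_def by argo
      qed
      then show "0 \<le> t" "t \<le> of_int \<bar>p\<bar>" by auto
    qed
    \<comment> \<open>The minimum only matters at the endpoint \<open>t = \<bar>p\<bar>\<close>, whose floor is not a digit.\<close>
    define i where "i = min \<lfloor>t\<rfloor> (\<bar>p\<bar> - 1)"
    have "i \<in> {0..\<bar>p\<bar> - 1}" using t assms by (auto simp: i_def)
    moreover have "0 \<le> t - of_int i" "t - of_int i \<le> 1"
      using t by (auto simp: i_def min_def) linarith+
    ultimately show ?thesis by (intro bexI[of _ i]) (auto simp: t_def)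
  qed
  then show ?thesis by (rule that)
qed

lemma integer_translate_into_interval:
  fixes c x :: real
  obtains k :: int where "x - of_int k \<in> {c..c + 1}"
proof -
  have "x - of_int \<lfloor>x - c\<rfloor> \<in> {c..c + 1}"
    by auto linarith+
  then show ?thesis by (rule that)
qed

text \<open>
  The bounded solution is the series obtained by iterating \<open>g x = (g (\<phi> x) - a x) / q\<close>.
\<close>
lemma bounded_skew_cocycle:
  fixes q a :: real and \<phi> :: "real \<Rightarrow> real"
  assumes q: "\<bar>q\<bar> > 1" and \<phi>: "\<And>x. x \<in> I \<Longrightarrow> \<phi> x \<in> I" and I: "bounded I"
  obtains g where "\<And>x. x \<in> I \<Longrightarrow> g (\<phi> x) = q * g x + a * x" "bounded (g ` I)"
proof -
  obtain M where M: "\<And>x. x \<in> I \<Longrightarrow> \<bar>x\<bar> \<le> M"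
    using I by (auto simp: bounded_iff)
  define s where "s = (\<lambda>x k. a * (\<phi> ^^ k) x / q ^ Suc k)"
  define g where "g = (\<lambda>x. - (\<Sum>k. s x k))"
  define B where "B = (\<lambda>k. \<bar>a\<bar> * M * (1 / \<bar>q\<bar>) ^ Suc k)"
  have orbit: "(\<phi> ^^ k) x \<in> I" if "x \<in> I" for x k
    by (induction k) (use that \<phi> in auto)
  have bound: "norm (s x k) \<le> B k" if "x \<in> I" for x k
  proof -
    have "\<bar>a\<bar> * \<bar>(\<phi> ^^ k) x\<bar> / \<bar>q\<bar> ^ Suc k \<le> \<bar>a\<bar> * M / \<bar>q\<bar> ^ Suc k"
      using M[OF orbit[OF that]] by (intro divide_right_mono mult_left_mono) auto
    then show ?thesis by (simp add: s_def B_def abs_mult power_abs power_divide)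
  qed
  have sumB: "summable B"
    unfolding B_def using q
    by (intro summable_mult) (simp add: summable_mult summable_geometric)
  have sums: "summable (s x)" if "x \<in> I" for x
    using summable_comparison_test'[OF sumB] bound[OF that] by blast
  show ?thesis
  proof
    fix x assume x: "x \<in> I"
    have "q * s x (Suc k) = s (\<phi> x) k" for k
      using q by (simp add: s_def funpow_swap1)
    then have "(\<Sum>k. s (\<phi> x) k) = q * (\<Sum>k. s x (Suc k))"
      using suminf_mult[of "\<lambda>k. s x (Suc k)" q] sums[OF x] summable_Suc_iff[of "s x"] by simp
    also have "\<dots> = q * (\<Sum>k. s x k) - q * s x 0"
      by (simp add: suminf_split_head[OF sums[OF x]] right_diff_distrib)
    also have "q * s x 0 = a * x" using q by (auto simp: s_def)
    finally show "g (\<phi> x) = q * g x + a * x"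
      by (simp add: g_def right_diff_distrib)
  next
    have "norm (g x) \<le> (\<Sum>k. B k)" if "x \<in> I" for x
    proof -
      have "summable (\<lambda>k. norm (s x k))"
        using summable_comparison_test'[OF sumB, of 0 "\<lambda>k. norm (s x k)"] bound[OF that] by auto
      then have "norm (\<Sum>k. s x k) \<le> (\<Sum>k. norm (s x k))" by (rule summable_norm)
      also have "\<dots> \<le> (\<Sum>k. B k)"
        using bound[OF that] \<open>summable (\<lambda>k. norm (s x k))\<close> sumB by (intro suminf_le) auto
      finally show ?thesis by (simp add: g_def)
    qed
    then show "bounded (g ` I)" by (auto simp: bounded_iff)
  qed
qed

lemma lower_tri_self_affine_set_not_negligible:
  fixes p q :: int and a :: real
  assumes p: "\<bar>p\<bar> \<ge> 2" and q: "\<bar>q\<bar> \<ge> 2"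
  shows "\<not> negligible (self_affine_set (lower_tri p a q) (rect_digits \<bar>p\<bar> \<bar>q\<bar>))"
proof
  let ?T = "self_affine_set (lower_tri p a q) (rect_digits \<bar>p\<bar> \<bar>q\<bar>)"
  let ?v = "\<lambda>x y. vector [x, y] :: real^2"
  assume neg: "negligible ?T"
  have "?v 0 0 \<in> rect_digits \<bar>p\<bar> \<bar>q\<bar>"
    using p q by (force simp: rect_digits_def)
  then interpret expanding_digit_system "lower_tri p a q" "rect_digits \<bar>p\<bar> \<bar>q\<bar>"
    "\<lambda>v. (2 * \<bar>a\<bar> + 1) * \<bar>v $ 1\<bar> + \<bar>v $ 2\<bar>" "3/2" 1 "(2 * \<bar>a\<bar> + 1) + 1"
    using p q by (intro lower_tri_expanding_digit_system finite_rect_digits) auto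
  obtain c :: real where c: "\<And>x. x \<in> {c..c + 1} \<Longrightarrow>
      \<exists>i\<in>{0..\<bar>p\<bar> - 1}. of_int p * x - of_int i \<in> {c..c + 1}"
    by (rule expanding_interval[of p]) (use p in auto)
  obtain e :: real where e: "\<And>x. x \<in> {e..e + 1} \<Longrightarrow>
      \<exists>i\<in>{0..\<bar>q\<bar> - 1}. of_int q * x - of_int i \<in> {e..e + 1}"
    by (rule expanding_interval[of q]) (use q in auto)
  obtain d where d: "\<And>x. x \<in> {c..c + 1} \<Longrightarrow>
      d x \<in> {0..\<bar>p\<bar> - 1} \<and> of_int p * x - of_int (d x) \<in> {c..c + 1}"
    using c by metis
  define \<phi> where "\<phi> = (\<lambda>x. of_int p * x - of_int (d x))"
  obtain g where g: "\<And>x. x \<in> {c..c + 1} \<Longrightarrow> g (\<phi> x) = of_int q * g x + a * x"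
      "bounded (g ` {c..c + 1})"
    using bounded_skew_cocycle[of "of_int q" "{c..c + 1}" \<phi> a] q d by (force simp: \<phi>_def)
  define E where "E = {v :: real^2. v $ 1 \<in> {c..c + 1} \<and> v $ 2 - g (v $ 1) \<in> {e..e + 1}}"
  have "bounded E"
  proof -
    obtain M where M: "\<And>x. x \<in> {c..c + 1} \<Longrightarrow> \<bar>g x\<bar> \<le> M"
      using g(2) unfolding bounded_iff by fastforce
    have "norm v \<le> (\<bar>c\<bar> + 1) + (M + \<bar>e\<bar> + 1)" if "v \<in> E" for v
    proof -
      have "\<bar>v $ 1\<bar> \<le> \<bar>c\<bar> + 1" using that by (auto simp: E_def)
      moreover have "\<bar>v $ 2\<bar> \<le> M + \<bar>e\<bar> + 1" using that M[of "v $ 1"] by (auto simp: E_def)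
      ultimately show ?thesis using norm_le_l1_cart[of v] by (simp add: sum_2)
    qed
    then show ?thesis by (auto simp: bounded_iff)
  qed
  moreover have "\<exists>u\<in>rect_digits \<bar>p\<bar> \<bar>q\<bar>. lower_tri p a q *v v - u \<in> E" if v: "v \<in> E" for v
  proof -
    have x: "v $ 1 \<in> {c..c + 1}" using v by (simp add: E_def)
    obtain j where j: "j \<in> {0..\<bar>q\<bar> - 1}"
      "of_int q * (v $ 2 - g (v $ 1)) - of_int j \<in> {e..e + 1}"
      using e[of "v $ 2 - g (v $ 1)"] v unfolding E_def by blast
    let ?u = "?v (of_int (d (v $ 1))) (of_int j)"
    have "?u \<in> rect_digits \<bar>p\<bar> \<bar>q\<bar>"
      using d[OF x] j by (force simp: rect_digits_def)
    moreover have "lower_tri p a q *v v - ?u \<in> E"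
      using d[OF x] g(1)[OF x] j by (simp add: E_def \<phi>_def algebra_simps)
    ultimately show ?thesis by blast
  qed
  ultimately have "E \<subseteq> ?T" by (rule subset_self_affine_set)
  \<comment> \<open>The integer translates of \<open>E\<close>, hence of the self-affine set, cover the plane.\<close>
  let ?Z = "(\<lambda>(k, l). ?v (of_int k) (of_int l)) ` (UNIV :: (int \<times> int) set)"
  have "(UNIV :: (real^2) set) \<subseteq> (\<Union>z\<in>?Z. (+) z ` ?T)"
  proof
    fix v :: "real^2"
    obtain k where k: "v $ 1 - of_int k \<in> {c..c + 1}"
      by (rule integer_translate_into_interval)
    obtain l where l: "v $ 2 - g (v $ 1 - of_int k) - of_int l \<in> {e..e + 1}"
      by (rule integer_translate_into_interval)
    have "v - ?v (of_int k) (of_int l) \<in> E"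
      using k l by (simp add: E_def algebra_simps)
    then have "v \<in> (+) (?v (of_int k) (of_int l)) ` ?T"
      using \<open>E \<subseteq> ?T\<close> by (intro image_eqI[of _ _ "v - ?v (of_int k) (of_int l)"]) auto
    then show "v \<in> (\<Union>z\<in>?Z. (+) z ` ?T)" by auto
  qed
  moreover have "negligible (\<Union>z\<in>?Z. (+) z ` ?T)"
    using neg by (intro negligible_countable_Union) (auto simp: negligible_translation)
  ultimately have "negligible (UNIV :: (real^2) set)"
    by (rule negligible_subset[rotated])
  then show False by simp
qed

section \<open>Which rectangular digit sets give tiles\<close>

theorem proposition1p4:
  fixes p q m n :: int and a :: real
    and A :: "real^2^2" and D :: "(real^2) set"
  assumes "\<bar>p\<bar> \<ge> 2" and "\<bar>q\<bar> \<ge> 2" and "m > 0" and "n > 0" and "\<bar>p * q\<bar> = m * n"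
    and "A = lower_tri p a q" and "D = rect_digits m n"
  shows "(m < \<bar>p\<bar> \<longrightarrow> \<not> is_tile A D) \<and>
         (m = \<bar>p\<bar> \<longrightarrow> is_tile A D) \<and>
         (m > \<bar>p\<bar> \<longrightarrow>
            (a = 0 \<longrightarrow> \<not> is_tile A D) \<and>
            (a \<in> \<int> - {0} \<and> 2 * n - 1 \<ge> \<bar>q\<bar> \<longrightarrow> \<not> is_tile A D))"
proof -
  let ?T = "self_affine_set A D"
  have "vector [0, 0] \<in> D"
    using assms by (force simp: rect_digits_def)
  then interpret expanding_digit_system A D
    "\<lambda>v. (2 * \<bar>a\<bar> + 1) * \<bar>v $ 1\<bar> + \<bar>v $ 2\<bar>" "3/2" 1 "(2 * \<bar>a\<bar> + 1) + 1"
    using assms lower_tri_expanding_digit_system[of p q D a] finite_rect_digits by auto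
  have card: "real (card D) = \<bar>det A\<bar>"
    using assms card_rect_digits[of m n] unfolding det_lower_tri
    by (metis det_lower_tri of_int_abs of_int_of_nat_eq)
  have T: "compact ?T" by (rule compact_self_affine_set)
  have tile_iff: "is_tile A D \<longleftrightarrow> \<not> negligible ?T"
    using finite_D card T
    by (auto simp: is_tile_def negligible_iff_emeasure0 lmeasurable_compact fmeasurableD zero_less_iff_neq_zero)
  have step: "\<exists>i\<in>{0..m - 1}. \<exists>j\<in>{0..n - 1}. A *v v - vector [of_int i, of_int j] \<in> ?T"
    if "v \<in> ?T" for v
    using self_affine_set_step[OF that] assms by (auto simp: rect_digits_eq_image)
  have abs_pq: "\<bar>p\<bar> * \<bar>q\<bar> = m * n" using assms by (simp add: abs_mult)
  have n_less: "n < \<bar>q\<bar>" if "\<bar>p\<bar> < m"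
  proof (rule ccontr)
    assume "\<not> n < \<bar>q\<bar>"
    then have "\<bar>p\<bar> * \<bar>q\<bar> < m * n"
      using that assms by (intro mult_less_le_imp_less) auto
    then show False using abs_pq by simp
  qed
  have "negligible ?T" if "m < \<bar>p\<bar>"
  proof (rule negligible_of_expanding_projection[OF T, where C = "of_int ` {0..m - 1}" and r = "of_int p" and i = 1])
    have "card (real_of_int ` {0..m - 1}) = nat m"
      by (subst card_image) (auto simp: inj_on_def)
    then show "real (card (real_of_int ` {0..m - 1})) < \<bar>of_int p\<bar>"
      using that assms by linarith
    show "\<exists>w\<in>?T. \<exists>c\<in>of_int ` {0..m - 1}. of_int p * v $ 1 = w $ 1 + c" if v: "v \<in> ?T" for v
    proof -
      obtain i j where "i \<in> {0..m - 1}" "A *v v - vector [of_int i, of_int j] \<in> ?T"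
        using step[OF v] by blast
      then show ?thesis
        using assms by (intro bexI[of _ "A *v v - vector [of_int i, of_int j]"] bexI[of _ "of_int i"]) auto
    qed
  qed auto
  moreover have "\<not> negligible ?T" if "m = \<bar>p\<bar>"
  proof -
    have "n = \<bar>q\<bar>" using abs_pq that assms by auto
    then show ?thesis
      using lower_tri_self_affine_set_not_negligible assms that by simp
  qed
  moreover have "negligible ?T" if "m > \<bar>p\<bar>" "a = 0"
  proof (rule negligible_of_expanding_projection[OF T, where C = "of_int ` {0..n - 1}" and r = "of_int q" and i = 2])
    have "card (real_of_int ` {0..n - 1}) = nat n"
      by (subst card_image) (auto simp: inj_on_def)
    then show "real (card (real_of_int ` {0..n - 1})) < \<bar>of_int q\<bar>"
      using n_less[OF that(1)] assms by linarith
    show "\<exists>w\<in>?T. \<exists>c\<in>of_int ` {0..n - 1}. of_int q * v $ 2 = w $ 2 + c" if v: "v \<in> ?T" for v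
    proof -
      obtain i j where "j \<in> {0..n - 1}" "A *v v - vector [of_int i, of_int j] \<in> ?T"
        using step[OF v] by blast
      then show ?thesis
        using assms \<open>a = 0\<close>
        by (intro bexI[of _ "A *v v - vector [of_int i, of_int j]"] bexI[of _ "of_int j"]) auto
    qed
  qed auto
  moreover have "negligible ?T" if h: "m > \<bar>p\<bar>" "a \<in> \<int>" "2 * n - 1 \<ge> \<bar>q\<bar>"
  proof -
    obtain b :: int where b: "a = of_int b" using \<open>a \<in> \<int>\<close> by (auto elim: Ints_cases)
    obtain xs ys where words: "set xs \<subseteq> D" "set ys \<subseteq> D" "length xs = length ys" "xs \<noteq> ys"
      "radix_value ((*v) A) xs = radix_value ((*v) A) ys"
    proof (rule lower_tri_radix_collision[of n q p m b])
      show "n > 0" "2 * n - 1 \<ge> \<bar>q\<bar>" "n < \<bar>q\<bar>" "\<bar>p\<bar> < m" "1 < m"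
        using h assms n_less by auto
    qed (use assms b in auto)
    have "real (card D) = \<bar>det (matrix ((*v) A))\<bar>"
      using card by (simp add: matrix_of_matrix_vector_mul)
    then show ?thesis
      by (rule negligible_of_radix_collision[OF matrix_vector_mul_linear T finite_D _ self_affine_set_step words])
  qed
  ultimately show ?thesis using tile_iff by blast
qed

end
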